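(* Let $K$ be an $n$-dimensional opetopic directed complex, and for $0\leq q\leq n$ let $N_q=G_q^-(\langle K\rangle)$. Then there is an $n$-dimensional opetopic sequence $N_0\to\ldots\to N_n$ such that the thin edges and vertices in $N_q$ correspond to the thin basis elements in $K$ (an edge or vertex of $N_q$ is thin exactly when the corresponding basis element is thin) and such that the constellations are the bijections from vertices to input edges induced by the structure of $\langle K\rangle$ (the vertex of $N_q$ corresponding to a basis element $a$ is sent to the input edge of $N_{q+1}$ corresponding to $a$).
   Context: **Complexes.** A *free augmented directed complex* $K$ is an augmented chain complex of free abelian groups $K_q$, $q\geq 0$ (boundary $\partial\colon K_{q+1}\to K_q$ with $\partial\partial=0$, $\partial=0$ on $K_0$, augmentation $\epsilon\colon K_0\to\mathbb{Z}$ with $\epsilon\partial=0$), together with a distinguished basis for each $K_q$. Members of the basis of $K_q$ are the $q$-dimensional basis elements. A "sum of basis elements" is a (possibly empty, possibly with repetitions) finite sum of basis elements; its terms are the basis elements occurring in it. For a chain $c$ write $\partial c=\partial^+c-\partial^-c$ where $\partial^+c,\partial^-c$ are sums of basis elements with no common terms; $(\partial^\pm)^r$ denotes the $r$-fold iterate of $\partial^\pm$. $K$ is *unital* if $\epsilon(\partial^-)^q a=\epsilon(\partial^+)^q a=1$ for each basis element $a$ of dimension $q$. $K$ is *loop-free* if its basis elements can be partially ordered so that, for any basis element $a$ and any integer $r>0$, the basis elements which are terms in $(\partial^-)^r a$ (strictly) precede those which are terms in $(\partial^+)^r a$. $K$ is *atomic of dimension $n$* (or $n$-dimensional atomic) if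 it has no basis elements of dimension greater than $n$, exactly one basis element of dimension $n$, and every basis element of dimension less than $n$ is a term in $\partial^-a$ or $\partial^+a$ for some higher-dimensional basis element $a$. An *opetopic directed complex* is an atomic loop-free unital free augmented directed complex with a distinguished class of positive-dimensional basis elements called *thin*, such that: (1) if $a$ is a positive-dimensional basis element then $\partial^+a$ is a non-thin basis element; (2) if $a$ is a thin basis element then $\partial^-a$ is a non-thin basis element. **Networks.** A *network* consists of finite sets $E$ (edges) and $V$ (vertices), subsets $I\subseteq E$ (input edges) and $O\subseteq E$ (output edges), and functions $s\colon E\setminus I\to V$, $t\colon E\setminus O\to V$ (source and target). A *path* from an edge $e'$ to an edge $e$ is a sequence $e_0,v_1,e_1,\dots,v_k,e_k$ ($k\ge 0$) of edges $e_r$ and vertices $v_r$ with $v_r=t(e_{r-1})=s(e_r)$, $e_0=e'$, $e_k=e$. A network is *acyclic* if there is no path from any edge $e$ to itself other than the single-term path $e$; it is *linear* if it is acyclic and consists of a single path (all its edges and vertices are those of one path). An *opetopic network* is an acyclic network with a unique output edge, with distinguished sets of *thin* edges and *thin* vertices, such that every thin edge is an input edge, and every thin vertex is the target for a unique edge, which is not thin. A *constellation* from an opetopic network $N$ to an opetopic network $P$ is a bijection $c$ from the set of vertices of $N$ to the set of input edges of $P$ such that thin vertices of $N$ correspond to thin edges of $P$ and such that: if $e$ is an edge of $P$ and $I_e$ is the set of input edges $e'$ of $P$ such that there is a path in $P$ from $e'$ to $e$, then there is exactly one edge in $N$ with a source but not a target in $c^{-1}(I_e)$. An $n$-dimensional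 *opetopic sequence* is a sequence of opetopic networks and constellations $N_0\to N_1\to\ldots\to N_n$ such that $N_0$ is linear with no thin edges and $N_n$ consists of a single edge. **The networks associated to $K$.** If $K$ is an $n$-dimensional opetopic directed complex with $n$-dimensional basis element $g$, let $x_q^\alpha=(\partial^\alpha)^{n-q}g$ for $0\leq q\leq n$ and $x_q^\alpha=0$ for $q>n$ ($\alpha=\pm$), and let $\langle K\rangle=(x_0^-,x_0^+\mid x_1^-,x_1^+\mid\ldots)$ (the canonical atom of $K$). Writing $x_{q+1}^-=a_1+\ldots+a_k$ as a sum of basis elements, put $g_q^-(\langle K\rangle)=x_q^-+\partial^+a_1+\ldots+\partial^+a_k$. The network $G_q^-(\langle K\rangle)$ has edges corresponding to the basis elements which are terms in $g_q^-(\langle K\rangle)$ and vertices corresponding to the $(q+1)$-dimensional basis elements which are terms in $x_{q+1}^-$; the edges with target the vertex corresponding to $a$ correspond to the terms of $\partial^-a$, and the edges with source the vertex corresponding to $a$ correspond to the terms of $\partial^+a$; edges without a source are input edges and edges without a target are output edges. The input edges of $G_{q+1}^-(\langle K\rangle)$ correspond to the terms of $x_{q+1}^-$. *)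

theory Defs
  imports "HOL-Algebra.Free_Abelian_Groups"
begin

section \<open>Free augmented directed complexes\<close>

text \<open>The group of \<open>q\<close>-chains is the free abelian group on \<open>basis K q\<close>. The boundary is a single
  function, restricted to each chain group in turn; for this the bases in different dimensions are
  required to be disjoint.\<close>

record 'a fadc =
  basis :: "nat \<Rightarrow> 'a set"
  bd :: "('a \<Rightarrow>\<^sub>0 int) \<Rightarrow> ('a \<Rightarrow>\<^sub>0 int)"
  aug :: "('a \<Rightarrow>\<^sub>0 int) \<Rightarrow> int"

definition chains :: "('a, 'm) fadc_scheme \<Rightarrow> nat \<Rightarrow> ('a \<Rightarrow>\<^sub>0 int) monoid"
  where "chains K q = free_Abelian_group (basis K q)"

definition all_basis :: "('a, 'm) fadc_scheme \<Rightarrow> 'a set"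
  where "all_basis K = (\<Union>q. basis K q)"

definition free_augmented_directed_complex :: "('a, 'm) fadc_scheme \<Rightarrow> bool"
  where "free_augmented_directed_complex K \<longleftrightarrow>
    (\<forall>p q. p \<noteq> q \<longrightarrow> basis K p \<inter> basis K q = {}) \<and>
    (\<forall>q. bd K \<in> hom (chains K (Suc q)) (chains K q)) \<and>
    (\<forall>c \<in> carrier (chains K 0). bd K c = 0) \<and>
    (\<forall>q. \<forall>c \<in> carrier (chains K (Suc q)). bd K (bd K c) = 0) \<and>
    aug K \<in> hom (chains K 0) integer_group \<and>
    (\<forall>c \<in> carrier (chains K 1). aug K (bd K c) = 0)"

datatype sign = Minus | Plus

text \<open>\<open>bdry K Plus c\<close> and \<open>bdry K Minus c\<close> are the positive and negative parts of the boundary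
  of \<open>c\<close>; \<open>bdry_decomposition\<close> and \<open>bdry_unique\<close> below show that they are the unique sums of basis elements without common
  terms whose difference is the boundary. The terms of a sum of basis elements are its keys.\<close>

fun bdry :: "('a, 'm) fadc_scheme \<Rightarrow> sign \<Rightarrow> ('a \<Rightarrow>\<^sub>0 int) \<Rightarrow> ('a \<Rightarrow>\<^sub>0 int)"
  where
    "bdry K Plus c = Poly_Mapping.map (\<lambda>k. max k 0) (bd K c)"
  | "bdry K Minus c = Poly_Mapping.map (\<lambda>k. max (- k) 0) (bd K c)"

declare bdry.simps [simp del]

definition basis_sum :: "('a \<Rightarrow>\<^sub>0 int) \<Rightarrow> bool"
  where "basis_sum c \<longleftrightarrow> (\<forall>a. 0 \<le> Poly_Mapping.lookup c a)"

lemma lookup_bdry: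
  "Poly_Mapping.lookup (bdry K Plus c) a = max (Poly_Mapping.lookup (bd K c) a) 0"
  "Poly_Mapping.lookup (bdry K Minus c) a = max (- Poly_Mapping.lookup (bd K c) a) 0"
  by (auto simp: bdry.simps Poly_Mapping.map.rep_eq when_def)

lemma bdry_decomposition:
  "basis_sum (bdry K Plus c)" "basis_sum (bdry K Minus c)"
  "Poly_Mapping.keys (bdry K Plus c) \<inter> Poly_Mapping.keys (bdry K Minus c) = {}"
  "bd K c = bdry K Plus c - bdry K Minus c"
     apply (auto simp: basis_sum_def lookup_bdry in_keys_iff)
  apply (rule poly_mapping_eqI)
  apply (auto simp: lookup_bdry lookup_minus)
  done

lemma bdry_unique:
  assumes "basis_sum u" "basis_sum v" "Poly_Mapping.keys u \<inter> Poly_Mapping.keys v = {}"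
    and "bd K c = u - v"
  shows "u = bdry K Plus c" "v = bdry K Minus c"
proof -
  have nn: "0 \<le> Poly_Mapping.lookup u a" "0 \<le> Poly_Mapping.lookup v a"
    and dj: "Poly_Mapping.lookup u a = 0 \<or> Poly_Mapping.lookup v a = 0"
    and eq: "Poly_Mapping.lookup (bd K c) a = Poly_Mapping.lookup u a - Poly_Mapping.lookup v a" for a
    using assms by (auto simp: basis_sum_def lookup_minus in_keys_iff disjoint_iff)
  show "u = bdry K Plus c"
    by (rule poly_mapping_eqI, unfold lookup_bdry eq) (smt (verit) nn dj)
  show "v = bdry K Minus c"
    by (rule poly_mapping_eqI, unfold lookup_bdry eq) (smt (verit) nn dj)
qed

definition unital :: "('a, 'm) fadc_scheme \<Rightarrow> bool"
  where "unital K \<longleftrightarrow>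
    (\<forall>q. \<forall>a \<in> basis K q. \<forall>\<alpha>. aug K ((bdry K \<alpha> ^^ q) (frag_of a)) = 1)"

definition loop_free :: "('a, 'm) fadc_scheme \<Rightarrow> bool"
  where "loop_free K \<longleftrightarrow>
    (\<exists>R. partial_order_on (all_basis K) R \<and>
      (\<forall>a \<in> all_basis K. \<forall>r > 0.
        \<forall>b \<in> Poly_Mapping.keys ((bdry K Minus ^^ r) (frag_of a)).
        \<forall>c \<in> Poly_Mapping.keys ((bdry K Plus ^^ r) (frag_of a)).
          (b, c) \<in> R \<and> b \<noteq> c))"

definition atomic :: "nat \<Rightarrow> ('a, 'm) fadc_scheme \<Rightarrow> bool"
  where "atomic n K \<longleftrightarrow>
    (\<forall>q > n. basis K q = {}) \<and>
    (\<exists>g. basis K n = {g}) \<and>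
    (\<forall>q < n. \<forall>b \<in> basis K q. \<exists>p > q. \<exists>a \<in> basis K p. \<exists>\<alpha>.
       b \<in> Poly_Mapping.keys (bdry K \<alpha> (frag_of a)))"

record 'a odc = "'a fadc" +
  thin :: "'a set"

definition opetopic_directed_complex :: "nat \<Rightarrow> ('a, 'm) odc_scheme \<Rightarrow> bool"
  where "opetopic_directed_complex n K \<longleftrightarrow>
    free_augmented_directed_complex K \<and> atomic n K \<and> loop_free K \<and> unital K \<and>
    thin K \<subseteq> (\<Union>q \<in> {0<..}. basis K q) \<and>
    (\<forall>q > 0. \<forall>a \<in> basis K q. \<exists>b \<in> all_basis K - thin K. bdry K Plus (frag_of a) = frag_of b) \<and>
    (\<forall>a \<in> thin K. \<exists>b \<in> all_basis K - thin K. bdry K Minus (frag_of a) = frag_of b)"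

section \<open>Networks\<close>

record ('e, 'v) network =
  edges :: "'e set"
  verts :: "'v set"
  inputs :: "'e set"
  outputs :: "'e set"
  src :: "'e \<Rightarrow> 'v"
  tgt :: "'e \<Rightarrow> 'v"

text \<open>The source and target functions are taken in extensional form, so that equal networks are
  equal as records.\<close>

definition network :: "('e, 'v, 'm) network_scheme \<Rightarrow> bool"
  where "network N \<longleftrightarrow>
    finite (edges N) \<and> finite (verts N) \<and> inputs N \<subseteq> edges N \<and> outputs N \<subseteq> edges N \<and>
    src N \<in> (edges N - inputs N) \<rightarrow>\<^sub>E verts N \<and>
    tgt N \<in> (edges N - outputs N) \<rightarrow>\<^sub>E verts N"

text \<open>The path with terms \<open>e\<^sub>0, v\<^sub>1, e\<^sub>1, \<dots>, v\<^sub>k, e\<^sub>k\<close> is given by the lists \<open>es = [e\<^sub>0, \<dots>, e\<^sub>k]\<close> and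
  \<open>vs = [v\<^sub>1, \<dots>, v\<^sub>k]\<close>, with zero-based positions.\<close>

definition is_path :: "('e, 'v, 'm) network_scheme \<Rightarrow> 'e list \<Rightarrow> 'v list \<Rightarrow> bool"
  where "is_path N es vs \<longleftrightarrow>
    length es = Suc (length vs) \<and> set es \<subseteq> edges N \<and> set vs \<subseteq> verts N \<and>
    (\<forall>r < length vs.
       es ! r \<notin> outputs N \<and> tgt N (es ! r) = vs ! r \<and>
       es ! Suc r \<notin> inputs N \<and> src N (es ! Suc r) = vs ! r)"

definition path_from_to ::
    "('e, 'v, 'm) network_scheme \<Rightarrow> 'e \<Rightarrow> 'e \<Rightarrow> 'e list \<Rightarrow> 'v list \<Rightarrow> bool"
  where "path_from_to N e' e es vs \<longleftrightarrow> is_path N es vs \<and> hd es = e' \<and> last es = e"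

definition acyclic_network :: "('e, 'v, 'm) network_scheme \<Rightarrow> bool"
  where "acyclic_network N \<longleftrightarrow>
    (\<forall>e \<in> edges N. \<forall>es vs. path_from_to N e e es vs \<longrightarrow> es = [e] \<and> vs = [])"

definition linear_network :: "('e, 'v, 'm) network_scheme \<Rightarrow> bool"
  where "linear_network N \<longleftrightarrow>
    acyclic_network N \<and> (\<exists>es vs. is_path N es vs \<and> edges N = set es \<and> verts N = set vs)"

record ('e, 'v) thin_network = "('e, 'v) network" +
  thin_edges :: "'e set"
  thin_verts :: "'v set"

definition opetopic_network :: "('e, 'v, 'm) thin_network_scheme \<Rightarrow> bool"
  where "opetopic_network N \<longleftrightarrow>
    network N \<and> acyclic_network N \<and> (\<exists>!e. e \<in> outputs N) \<and>
    thin_edges N \<subseteq> inputs N \<and> thin_verts N \<subseteq> verts N \<and>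
    (\<forall>v \<in> thin_verts N. \<exists>e. {e' \<in> edges N - outputs N. tgt N e' = v} = {e} \<and> e \<notin> thin_edges N)"

definition inputs_below :: "('e, 'v, 'm) network_scheme \<Rightarrow> 'e \<Rightarrow> 'e set"
  where "inputs_below P e = {e' \<in> inputs P. \<exists>es vs. path_from_to P e' e es vs}"

definition constellation ::
    "('e, 'v, 'm) thin_network_scheme \<Rightarrow> ('f, 'w, 'n) thin_network_scheme \<Rightarrow> ('v \<Rightarrow> 'f) \<Rightarrow> bool"
  where "constellation N P c \<longleftrightarrow>
    bij_betw c (verts N) (inputs P) \<and>
    c ` thin_verts N = thin_edges P \<and>
    (\<forall>e \<in> edges P. let S = {v \<in> verts N. c v \<in> inputs_below P e} in
       \<exists>!d. d \<in> edges N \<and>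
         (d \<notin> inputs N \<and> src N d \<in> S) \<and> \<not> (d \<notin> outputs N \<and> tgt N d \<in> S))"

definition opetopic_sequence ::
    "nat \<Rightarrow> (nat \<Rightarrow> ('e, 'v, 'm) thin_network_scheme) \<Rightarrow> (nat \<Rightarrow> 'v \<Rightarrow> 'e) \<Rightarrow> bool"
  where "opetopic_sequence n N c \<longleftrightarrow>
    (\<forall>q \<le> n. opetopic_network (N q)) \<and>
    (\<forall>q < n. constellation (N q) (N (Suc q)) (c q)) \<and>
    linear_network (N 0) \<and> thin_edges (N 0) = {} \<and>
    (\<exists>e. edges (N n) = {e}) \<and> verts (N n) = {}"

section \<open>The networks associated to a complex\<close>

text \<open>The canonical atom: \<open>canonical_atom n K \<alpha> q\<close> is its component of sign \<open>\<alpha>\<close> in dimension \<open>q\<close>,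
  where \<open>n\<close> is the dimension of the atomic complex \<open>K\<close>.\<close>

definition canonical_atom :: "nat \<Rightarrow> ('a, 'm) fadc_scheme \<Rightarrow> sign \<Rightarrow> nat \<Rightarrow> ('a \<Rightarrow>\<^sub>0 int)"
  where "canonical_atom n K \<alpha> q =
    (if q \<le> n then (bdry K \<alpha> ^^ (n - q)) (frag_of (the_elem (basis K n))) else 0)"

text \<open>Here \<open>frag_extend\<close> sums over the terms of \<open>x Minus (Suc q)\<close> with multiplicity.\<close>

definition g_minus ::
    "('a, 'm) fadc_scheme \<Rightarrow> (sign \<Rightarrow> nat \<Rightarrow> ('a \<Rightarrow>\<^sub>0 int)) \<Rightarrow> nat \<Rightarrow> ('a \<Rightarrow>\<^sub>0 int)"
  where "g_minus K x q =
    x Minus q + frag_extend (\<lambda>a. bdry K Plus (frag_of a)) (x Minus (Suc q))"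

text \<open>\<open>is_G_minus K x q N\<close> says that the underlying network of \<open>N\<close> is \<open>G\<^sub>q\<^sup>-(x)\<close>, with basis elements
  themselves as edges and vertices. That an edge has a source means that it is not an input edge,
  and similarly for targets; since these functions take values among the vertices, the last two
  clauses also determine the input and output edges (see the lemma below).\<close>

definition is_G_minus ::
    "('a, 'm) fadc_scheme \<Rightarrow> (sign \<Rightarrow> nat \<Rightarrow> ('a \<Rightarrow>\<^sub>0 int)) \<Rightarrow> nat \<Rightarrow> ('a, 'a, 'k) network_scheme \<Rightarrow> bool"
  where "is_G_minus K x q N \<longleftrightarrow>
    network N \<and>
    edges N = Poly_Mapping.keys (g_minus K x q) \<and>
    verts N = Poly_Mapping.keys (x Minus (Suc q)) \<and>
    (\<forall>a \<in> verts N.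
       {e \<in> edges N - outputs N. tgt N e = a} = Poly_Mapping.keys (bdry K Minus (frag_of a)) \<and>
       {e \<in> edges N - inputs N. src N e = a} = Poly_Mapping.keys (bdry K Plus (frag_of a)))"

lemma is_G_minus_unique:
  fixes N N' :: "('a, 'a, 'k) network_scheme"
  assumes "is_G_minus K x q N" "is_G_minus K x q N'"
  shows "network.truncate N = network.truncate N'"
proof -
  have E: "edges N = edges N'" and V: "verts N = verts N'"
    using assms by (auto simp: is_G_minus_def)
  have spec: "{e \<in> edges M - outputs M. tgt M e = a} = Poly_Mapping.keys (bdry K Minus (frag_of a))"
      "{e \<in> edges M - inputs M. src M e = a} = Poly_Mapping.keys (bdry K Plus (frag_of a))"
    if "is_G_minus K x q M" "a \<in> verts M" for M :: "('a, 'a, 'k) network_scheme" and a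
    using that unfolding is_G_minus_def by blast+
  have t: "{e \<in> edges N - outputs N. tgt N e = a} = {e \<in> edges N' - outputs N'. tgt N' e = a}"
    and s: "{e \<in> edges N - inputs N. src N e = a} = {e \<in> edges N' - inputs N'. src N' e = a}"
    if "a \<in> verts N" for a
    using spec[OF assms(1)] spec[OF assms(2)] that V by simp_all
  have n: "src N \<in> (edges N - inputs N) \<rightarrow>\<^sub>E verts N" "tgt N \<in> (edges N - outputs N) \<rightarrow>\<^sub>E verts N"
    "src N' \<in> (edges N - inputs N') \<rightarrow>\<^sub>E verts N" "tgt N' \<in> (edges N - outputs N') \<rightarrow>\<^sub>E verts N"
    and io: "inputs N \<subseteq> edges N" "outputs N \<subseteq> edges N" "inputs N' \<subseteq> edges N" "outputs N' \<subseteq> edges N"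
    using assms E V by (auto simp: is_G_minus_def network_def)
  have a1: "e \<in> edges N - inputs N' \<and> src N' e = src N e" if "e \<in> edges N - inputs N" for e
    using s[of "src N e"] PiE_mem[OF n(1) that] that E by blast
  have a2: "e \<in> edges N - inputs N" if "e \<in> edges N - inputs N'" for e
    using s[of "src N' e"] PiE_mem[OF n(3) that] that E by blast
  have b1: "e \<in> edges N - outputs N' \<and> tgt N' e = tgt N e" if "e \<in> edges N - outputs N" for e
    using t[of "tgt N e"] PiE_mem[OF n(2) that] that E by blast
  have b2: "e \<in> edges N - outputs N" if "e \<in> edges N - outputs N'" for e
    using t[of "tgt N' e"] PiE_mem[OF n(4) that] that E by blast
  have I: "inputs N = inputs N'" and O: "outputs N = outputs N'"
    using a1 a2 b1 b2 io by blast+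
  have "src N = src N'"
    by (rule PiE_ext[OF n(1)]) (use n(3) I a1 in auto)
  moreover have "tgt N = tgt N'"
    by (rule PiE_ext[OF n(2)]) (use n(4) O b1 in auto)
  ultimately show ?thesis
    using E V I O by (simp add: network.truncate_def)
qed

end

theory Submission
  imports Defs
begin

text \<open>Let \<open>x\<close> and \<open>y\<close> be sums of basis elements and let \<open>c\<close> be a sum of basis elements with
  \<open>\<partial>c = y - x\<close>. By loop-freeness some \<open>\<partial>\<^sup>+a\<close> with \<open>a\<close> a term of \<open>c\<close> is not consumed by any other
  term, so it occurs in \<open>y\<close>; removing \<open>a\<close> from \<open>c\<close> and replacing \<open>\<partial>\<^sup>+a\<close> by \<open>\<partial>\<^sup>-a\<close> in \<open>y\<close> one sees by
  induction, starting from augmentation \<open>1\<close> in dimension \<open>0\<close>, that all the sums in the canonical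
  atom and in \<open>g\<^sub>q\<^sup>-\<close> are free of repetitions. Hence sources and targets in the networks are
  well defined, and edges strictly increase along paths. For the constellation condition, the
  vertices on the paths leading to an edge \<open>e\<close> have a sum whose boundary is \<open>e - z\<close>, where \<open>z\<close> is the sum of
  the inputs below \<open>e\<close>; so \<open>\<partial>z = \<partial>e\<close>, and the edges with a source but not a target in \<open>z\<close> are the
  terms of \<open>\<partial>\<^sup>+z = \<partial>\<^sup>+e\<close>, of which there is one.\<close>

section \<open>Sums of basis elements\<close>

abbreviation lookup where "lookup \<equiv> Poly_Mapping.lookup"
abbreviation keys where "keys \<equiv> Poly_Mapping.keys"

definition multiplicity_free :: "('a \<Rightarrow>\<^sub>0 int) \<Rightarrow> bool"
  where "multiplicity_free c \<longleftrightarrow> (\<forall>a. lookup c a \<le> 1)"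

lemma basis_sum_keys_iff: "basis_sum c \<Longrightarrow> a \<in> keys c \<longleftrightarrow> lookup c a \<ge> 1"
  by (auto simp: basis_sum_def in_keys_iff) (smt (verit))

lemma basis_sum_0 [simp]: "basis_sum 0"
  by (simp add: basis_sum_def)

lemma basis_sum_frag_of [simp]: "basis_sum (frag_of a)"
  by (simp add: basis_sum_def)

lemma basis_sum_add: "basis_sum c \<Longrightarrow> basis_sum d \<Longrightarrow> basis_sum (c + d)"
  by (simp add: basis_sum_def lookup_add)

lemma basis_sum_bdry [simp]: "basis_sum (bdry K \<alpha> c)"
  by (cases \<alpha>) (simp_all add: bdry_decomposition)

lemma basis_sum_remove:
  assumes "basis_sum c" "a \<in> keys c"
  shows "basis_sum (c - frag_of a)"
  using assms basis_sum_keys_iff[of c a] by (auto simp: basis_sum_def lookup_minus)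

lemma keys_add_basis_sum:
  assumes "basis_sum c" "basis_sum d"
  shows "keys (c + d) = keys c \<union> keys d"
  using assms by (auto simp: basis_sum_def in_keys_iff lookup_add add_nonneg_eq_0_iff)

lemma lookup_frag_extend:
  "lookup (frag_extend f c) e = (\<Sum>a\<in>keys c. lookup c a * lookup (f a) e)"
  by (simp add: frag_extend_def lookup_sum)

lemma basis_sum_frag_extend:
  assumes "basis_sum c" "\<And>a. basis_sum (f a)"
  shows "basis_sum (frag_extend f c)"
  using assms by (auto simp: basis_sum_def lookup_frag_extend intro!: sum_nonneg)

lemma lookup_frag_extend_ge:
  assumes "basis_sum c" "\<And>a. basis_sum (f a)" "A \<subseteq> keys c"
  shows "(\<Sum>a\<in>A. lookup c a * lookup (f a) e) \<le> lookup (frag_extend f c) e"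
  unfolding lookup_frag_extend
  using assms by (intro sum_mono2) (auto simp: basis_sum_def)

lemma keys_frag_extend_eq:
  assumes "basis_sum c" "\<And>a. basis_sum (f a)"
  shows "keys (frag_extend f c) = (\<Union>a\<in>keys c. keys (f a))"
proof
  show "(\<Union>a\<in>keys c. keys (f a)) \<subseteq> keys (frag_extend f c)"
  proof clarify
    fix a e assume a: "a \<in> keys c" "e \<in> keys (f a)"
    then have "1 * 1 \<le> lookup c a * lookup (f a) e"
      using basis_sum_keys_iff[of c a] basis_sum_keys_iff[of "f a" e] assms
      by (intro mult_mono) auto
    also have "\<dots> \<le> lookup (frag_extend f c) e"
      using lookup_frag_extend_ge[of c f "{a}" e] a assms by simp
    finally show "e \<in> keys (frag_extend f c)"
      using basis_sum_keys_iff[OF basis_sum_frag_extend[OF assms]] by simp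
  qed
qed (rule keys_frag_extend)

text \<open>Two different terms sharing \<open>e\<close> would give it a coefficient of at least 2.
  This is what makes sources and targets in the networks single-valued.\<close>

lemma multiplicity_free_unique:
  assumes "basis_sum c" "\<And>a. basis_sum (f a)" "multiplicity_free (frag_extend f c)"
    and "a \<in> keys c" "b \<in> keys c" "e \<in> keys (f a)" "e \<in> keys (f b)"
  shows "a = b"
proof (rule ccontr)
  assume "a \<noteq> b"
  have "1 * 1 \<le> lookup c a * lookup (f a) e" "1 * 1 \<le> lookup c b * lookup (f b) e"
    using basis_sum_keys_iff assms by (intro mult_mono; fastforce)+
  then have "2 \<le> (\<Sum>a\<in>{a, b}. lookup c a * lookup (f a) e)"
    using \<open>a \<noteq> b\<close> by simp
  also have "\<dots> \<le> lookup (frag_extend f c) e"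
    using assms by (intro lookup_frag_extend_ge) auto
  finally show False
    using assms(3) by (simp add: multiplicity_free_def) (smt (verit))
qed

text \<open>A repeated term \<open>a\<close> would repeat every term of \<open>f a\<close>, and
  \<open>f a\<close> has one because it is nonzero. With positive faces for \<open>f\<close>, this
  lifts multiplicity-freeness by one dimension.\<close>

lemma multiplicity_free_frag_extendD:
  assumes "basis_sum c" "\<And>a. basis_sum (f a)" "multiplicity_free (frag_extend f c)"
    and "\<And>a. a \<in> keys c \<Longrightarrow> f a \<noteq> 0"
  shows "multiplicity_free c"
  unfolding multiplicity_free_def
proof
  fix a
  show "lookup c a \<le> 1"
  proof (cases "a \<in> keys c")
    case True
    then obtain e where e: "e \<in> keys (f a)"
      using assms(4) by fastforce
    have "lookup c a * 1 \<le> lookup c a * lookup (f a) e"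
      using basis_sum_keys_iff[OF assms(2)] e assms(1) by (intro mult_left_mono) (auto simp: basis_sum_def)
    also have "\<dots> \<le> lookup (frag_extend f c) e"
      using lookup_frag_extend_ge[of c f "{a}" e] True assms by simp
    also have "\<dots> \<le> 1"
      using assms(3) by (simp add: multiplicity_free_def)
    finally show ?thesis by simp
  qed (simp add: in_keys_iff)
qed

lemma lookup_multiplicity_free:
  assumes "basis_sum c" "multiplicity_free c"
  shows "lookup c a = of_bool (a \<in> keys c)"
proof -
  have "lookup c a \<le> 1" using assms by (simp add: multiplicity_free_def)
  then show ?thesis
    using basis_sum_keys_iff[OF assms(1)] by (auto simp: in_keys_iff intro: order_antisym)
qed

lemma multiplicity_free_mono:
  assumes "multiplicity_free d" "basis_sum (d - c)"
  shows "multiplicity_free c"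
  using assms by (auto simp: multiplicity_free_def basis_sum_def lookup_minus) (smt (verit))

lemma disjoint_keys_multiplicity_free:
  assumes "multiplicity_free (u + v)" "basis_sum u" "basis_sum v"
  shows "keys u \<inter> keys v = {}"
proof (rule equals0I)
  fix e assume "e \<in> keys u \<inter> keys v"
  then have "1 \<le> lookup u e" "1 \<le> lookup v e"
    using assms basis_sum_keys_iff[of u e] basis_sum_keys_iff[of v e] by auto
  moreover have "lookup (u + v) e \<le> 1"
    using assms(1) by (simp add: multiplicity_free_def)
  ultimately show False by (simp add: lookup_add)
qed

section \<open>Sums over finite sets, and the number of terms of a sum\<close>

definition chain_of :: "'a set \<Rightarrow> 'a \<Rightarrow>\<^sub>0 int"
  where "chain_of A = (\<Sum>a\<in>A. frag_of a)"

lemma lookup_chain_of: "finite A \<Longrightarrow> lookup (chain_of A) a = of_bool (a \<in> A)"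
  by (simp add: chain_of_def lookup_sum)

lemma keys_chain_of [simp]: "finite A \<Longrightarrow> keys (chain_of A) = A"
  by (auto simp: in_keys_iff lookup_chain_of)

lemma basis_sum_chain_of [simp]: "finite A \<Longrightarrow> basis_sum (chain_of A)"
  by (simp add: basis_sum_def lookup_chain_of)

text \<open>Since \<open>c - chain_of A\<close> has nonnegative coefficients, the image of
  \<open>chain_of A\<close> lies below that of \<open>c\<close>. So it inherits
  multiplicity-freeness and is determined by its terms.\<close>

lemma lookup_frag_extend_chain_of:
  assumes c: "basis_sum c" and f: "\<And>a. basis_sum (f a)"
    and mf: "multiplicity_free (frag_extend f c)" and A: "A \<subseteq> keys c"
  shows "lookup (frag_extend f (chain_of A)) e = of_bool (\<exists>a\<in>A. e \<in> keys (f a))"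
proof -
  have fin: "finite A"
    using A by (rule finite_subset) simp
  have "basis_sum (c - chain_of A)"
    unfolding basis_sum_def
  proof
    fix a show "0 \<le> lookup (c - chain_of A) a"
      using c basis_sum_keys_iff[OF c, of a] A
      by (auto simp: lookup_minus lookup_chain_of[OF fin] basis_sum_def)
  qed
  then have "basis_sum (frag_extend f c - frag_extend f (chain_of A))"
    by (metis basis_sum_frag_extend f frag_extend_diff)
  then have "multiplicity_free (frag_extend f (chain_of A))"
    using mf multiplicity_free_mono by blast
  then show ?thesis
    using fin f by (simp add: lookup_multiplicity_free basis_sum_frag_extend keys_frag_extend_eq)
qed

text \<open>The sum of the coefficients, obtained as a homomorphism to the free abelian group on one
  generator so that additivity comes from \<open>frag_extend\<close>. In dimension 0 of a unital
  complex it is the augmentation; elsewhere it counts terms and serves as an induction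
  measure.\<close>

definition total :: "('a \<Rightarrow>\<^sub>0 int) \<Rightarrow> int"
  where "total c = lookup (frag_extend (\<lambda>_. frag_of ()) c) ()"

lemma total_simps [simp]:
  "total 0 = 0" "total (frag_of a) = 1" "total (c + d) = total c + total d"
  "total (c - d) = total c - total d"
  by (simp_all add: total_def frag_extend_add frag_extend_diff lookup_add lookup_minus)

lemma total_nonneg: "basis_sum c \<Longrightarrow> 0 \<le> total c"
  using basis_sum_frag_extend[of c "\<lambda>_. frag_of ()"] by (simp add: total_def basis_sum_def)

lemma total_pos:
  assumes "basis_sum c" "a \<in> keys c"
  shows "0 < total c"
  using total_nonneg[OF basis_sum_remove[OF assms]] by simp

lemma multiplicity_free_total:
  assumes "basis_sum c" "total c = 1"
  shows "multiplicity_free c"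
  by (rule multiplicity_free_frag_extendD[OF assms(1), of "\<lambda>_. frag_of ()"])
     (use assms in \<open>auto simp: total_def multiplicity_free_def\<close>)

text \<open>Removing one term leaves total 0, whereas any further term would make the total
  positive.\<close>

lemma total_eq_1D:
  assumes "basis_sum c" "total c = 1"
  shows "\<exists>a. c = frag_of a"
proof -
  obtain a where a: "a \<in> keys c"
    using assms(2) by fastforce
  have "keys (c - frag_of a) = {}"
    using total_pos[OF basis_sum_remove[OF assms(1) a]] assms(2) by fastforce
  then show ?thesis by auto
qed

section \<open>Paths in networks\<close>

text \<open>Reachability by paths becomes the reflexive transitive closure of this relation.
  Membership of the middle vertex in \<open>verts N\<close> is demanded because
  \<open>is_path\<close> demands it and \<open>N\<close> is an arbitrary record here.\<close>

definition edge_step :: "('e, 'v, 'm) network_scheme \<Rightarrow> ('e \<times> 'e) set"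
  where "edge_step N = {(d, e). d \<in> edges N - outputs N \<and> e \<in> edges N - inputs N \<and>
    tgt N d \<in> verts N \<and> tgt N d = src N e}"

lemma is_path_Nil: "is_path N es [] \<longleftrightarrow> (\<exists>e\<in>edges N. es = [e])"
  by (auto simp: is_path_def length_Suc_conv)

lemma is_path_Cons:
  "is_path N (e # es) (v # vs) \<longleftrightarrow>
    es \<noteq> [] \<and> (e, hd es) \<in> edge_step N \<and> tgt N e = v \<and> is_path N es vs"
  by (cases es) (auto simp: is_path_def edge_step_def nth_Cons All_less_Suc2 split: nat.splits)

text \<open>The reflexive closure serves reachability; the second conjunct, for paths with at least
  one vertex, turns a closed path into a cycle of the relation.\<close>

lemma path_from_to_edge_step:
  "path_from_to N d e es vs \<Longrightarrow> (d, e) \<in> (edge_step N)\<^sup>* \<and> (vs \<noteq> [] \<longrightarrow> (d, e) \<in> (edge_step N)\<^sup>+)"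
proof (induction vs arbitrary: d es)
  case Nil
  then show ?case by (auto simp: path_from_to_def is_path_Nil)
next
  case (Cons v vs)
  obtain es' where es: "es = d # es'"
    using Cons.prems by (cases es) (auto simp: path_from_to_def is_path_def)
  then have "(d, hd es') \<in> edge_step N" "path_from_to N (hd es') e es' vs"
    using Cons.prems by (auto simp: path_from_to_def is_path_Cons)
  then show ?case
    using Cons.IH by (meson converse_rtrancl_into_rtrancl rtrancl_into_trancl2)
qed

lemma edge_step_path_from_to:
  assumes "(d, e) \<in> (edge_step N)\<^sup>*" "e \<in> edges N"
  shows "\<exists>es vs. path_from_to N d e es vs"
  using assms
proof (induction rule: converse_rtrancl_induct)
  case base
  then show ?case
    by (intro exI[of _ "[e]"] exI[of _ "[]"]) (simp add: path_from_to_def is_path_Nil)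
next
  case (step d d')
  then obtain es vs where *: "path_from_to N d' e es vs" by blast
  then have "es \<noteq> []" by (auto simp: path_from_to_def is_path_def)
  then have "path_from_to N d e (d # es) (tgt N d # vs)"
    using * step.hyps by (auto simp: path_from_to_def is_path_Cons)
  then show ?case by blast
qed

lemma acyclic_network_edge_step:
  assumes "acyclic (edge_step N)"
  shows "acyclic_network N"
  unfolding acyclic_network_def
proof clarify
  fix e es vs assume *: "path_from_to N e e es vs"
  then have "vs = []"
    using path_from_to_edge_step[OF *] assms by (auto simp: acyclic_def)
  then show "es = [e] \<and> vs = []"
    using * by (auto simp: path_from_to_def is_path_Nil)
qed

section \<open>Pasting diagrams\<close>

text \<open>The linear extension of \<open>\<partial>\<^sup>+\<close> from basis elements. On a
  longer sum it differs in general from \<open>bdry K Plus c\<close>, where faces shared by several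
  terms may cancel.\<close>

definition dplus :: "('a, 'm) fadc_scheme \<Rightarrow> ('a \<Rightarrow>\<^sub>0 int) \<Rightarrow> ('a \<Rightarrow>\<^sub>0 int)"
  where "dplus K = frag_extend (\<lambda>a. bdry K Plus (frag_of a))"

definition dminus :: "('a, 'm) fadc_scheme \<Rightarrow> ('a \<Rightarrow>\<^sub>0 int) \<Rightarrow> ('a \<Rightarrow>\<^sub>0 int)"
  where "dminus K = frag_extend (\<lambda>a. bdry K Minus (frag_of a))"

lemma dplus_simps [simp]:
  "dplus K 0 = 0" "dplus K (frag_of a) = bdry K Plus (frag_of a)"
  "dplus K (c + d) = dplus K c + dplus K d" "dplus K (c - d) = dplus K c - dplus K d"
  by (simp_all add: dplus_def frag_extend_add frag_extend_diff)

lemma dminus_simps [simp]: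
  "dminus K 0 = 0" "dminus K (frag_of a) = bdry K Minus (frag_of a)"
  "dminus K (c + d) = dminus K c + dminus K d" "dminus K (c - d) = dminus K c - dminus K d"
  by (simp_all add: dminus_def frag_extend_add frag_extend_diff)

lemma basis_sum_dplus: "basis_sum c \<Longrightarrow> basis_sum (dplus K c)"
  and basis_sum_dminus: "basis_sum c \<Longrightarrow> basis_sum (dminus K c)"
  by (simp_all add: dplus_def dminus_def basis_sum_frag_extend)

lemma keys_dplus: "basis_sum c \<Longrightarrow> keys (dplus K c) = (\<Union>a\<in>keys c. keys (bdry K Plus (frag_of a)))"
  and keys_dminus: "basis_sum c \<Longrightarrow> keys (dminus K c) = (\<Union>a\<in>keys c. keys (bdry K Minus (frag_of a)))"
  by (simp_all add: dplus_def dminus_def keys_frag_extend_eq)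

lemma dplus_unique:
  assumes "basis_sum c" "multiplicity_free (dplus K c)" "a \<in> keys c" "b \<in> keys c"
    and "e \<in> keys (bdry K Plus (frag_of a))" "e \<in> keys (bdry K Plus (frag_of b))"
  shows "a = b"
  using assms unfolding dplus_def
  by (intro multiplicity_free_unique[where f = "\<lambda>a. bdry K Plus (frag_of a)"]) auto

lemma dminus_unique:
  assumes "basis_sum c" "multiplicity_free (dminus K c)" "a \<in> keys c" "b \<in> keys c"
    and "e \<in> keys (bdry K Minus (frag_of a))" "e \<in> keys (bdry K Minus (frag_of b))"
  shows "a = b"
  using assms unfolding dminus_def
  by (intro multiplicity_free_unique[where f = "\<lambda>a. bdry K Minus (frag_of a)"]) auto

lemma lookup_dplus_chain_of:
  assumes "basis_sum c" "multiplicity_free (dplus K c)" "A \<subseteq> keys c"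
  shows "lookup (dplus K (chain_of A)) e = of_bool (\<exists>a\<in>A. e \<in> keys (bdry K Plus (frag_of a)))"
  using assms unfolding dplus_def by (intro lookup_frag_extend_chain_of) auto

lemma lookup_dminus_chain_of:
  assumes "basis_sum c" "multiplicity_free (dminus K c)" "A \<subseteq> keys c"
  shows "lookup (dminus K (chain_of A)) e = of_bool (\<exists>a\<in>A. e \<in> keys (bdry K Minus (frag_of a)))"
  using assms unfolding dminus_def by (intro lookup_frag_extend_chain_of) auto

section \<open>Acyclicity of the face relation\<close>

definition face_step :: "('a, 'm) fadc_scheme \<Rightarrow> ('a \<times> 'a) set"
  where "face_step K = {(b, c). \<exists>a\<in>all_basis K.
    b \<in> keys (bdry K Minus (frag_of a)) \<and> c \<in> keys (bdry K Plus (frag_of a))}"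

text \<open>The case \<open>r = 1\<close> of loop-freeness puts the face relation inside the strict
  part of a partial order, which is transitive and irreflexive.\<close>

lemma acyclic_face_step:
  assumes "loop_free K"
  shows "acyclic (face_step K)"
proof -
  obtain R where R: "partial_order_on (all_basis K) R \<and> (\<forall>a\<in>all_basis K. \<forall>r>0.
      \<forall>b\<in>keys ((bdry K Minus ^^ r) (frag_of a)). \<forall>c\<in>keys ((bdry K Plus ^^ r) (frag_of a)).
      (b, c) \<in> R \<and> b \<noteq> c)"
    using assms unfolding loop_free_def ..
  have "face_step K \<subseteq> R - Id"
    unfolding face_step_def using R[THEN conjunct2, rule_format, of _ 1] by auto
  moreover have "trans (R - Id)"
    using R by (simp add: partial_order_on_def preorder_on_def trans_diff_Id)
  then have "acyclic (R - Id)"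
    by (simp add: acyclic_def)
  ultimately show ?thesis
    using acyclic_subset by blast
qed

section \<open>Boundary and augmentation in an opetopic complex\<close>

locale opetopic_complex =
  fixes K :: "('a, 'm) odc_scheme" and n :: nat
  assumes opetopic: "opetopic_directed_complex n K"
begin

lemma complex: "free_augmented_directed_complex K" "atomic n K" "loop_free K" "unital K"
  using opetopic by (simp_all add: opetopic_directed_complex_def)

lemma all_basisI: "a \<in> basis K q \<Longrightarrow> a \<in> all_basis K"
  by (auto simp: all_basis_def)

lemma bd_hom: "bd K \<in> hom (free_Abelian_group (basis K (Suc q))) (free_Abelian_group (basis K q))"
  using complex(1) by (simp add: free_augmented_directed_complex_def chains_def)

lemma keys_bd: "keys c \<subseteq> basis K (Suc q) \<Longrightarrow> keys (bd K c) \<subseteq> basis K q"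
  using hom_in_carrier[OF bd_hom[of q], of c] by simp

lemma keys_bdry: "keys c \<subseteq> basis K (Suc q) \<Longrightarrow> keys (bdry K \<alpha> c) \<subseteq> basis K q"
  using keys_bd[of c q] by (cases \<alpha>) (auto simp: in_keys_iff lookup_bdry max_def split: if_splits)

lemma bd_add: "keys c \<subseteq> basis K (Suc q) \<Longrightarrow> keys d \<subseteq> basis K (Suc q) \<Longrightarrow> bd K (c + d) = bd K c + bd K d"
  using hom_frag_add[OF bd_hom] by blast

lemma bd_diff: "keys c \<subseteq> basis K (Suc q) \<Longrightarrow> keys d \<subseteq> basis K (Suc q) \<Longrightarrow> bd K (c - d) = bd K c - bd K d"
  using hom_frag_diff[OF bd_hom] by blast

lemma bd_0 [simp]: "bd K 0 = 0"
  using bd_diff[of 0 0 0] by simp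

lemma bd_bd:
  assumes "keys c \<subseteq> basis K (Suc q)"
  shows "bd K (bd K c) = 0"
proof -
  have "\<forall>c\<in>carrier (chains K (Suc q)). bd K (bd K c) = 0"
    using complex(1) unfolding free_augmented_directed_complex_def by blast
  then show ?thesis
    using assms by (simp add: chains_def)
qed

lemma bd_eq:
  assumes "keys c \<subseteq> basis K (Suc q)"
  shows "bd K c = dplus K c - dminus K c"
  using assms
proof (rule free_Abelian_group_induct)
  show "bd K (x - y) = dplus K (x - y) - dminus K (x - y)"
    if "keys x \<subseteq> basis K (Suc q)" "keys y \<subseteq> basis K (Suc q)"
      "bd K x = dplus K x - dminus K x" "bd K y = dplus K y - dminus K y" for x y
    using that by (simp add: bd_diff)
  show "bd K (frag_of a) = dplus K (frag_of a) - dminus K (frag_of a)" for a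
    using bdry_decomposition(4)[of K "frag_of a"] by simp
qed simp

lemma bdry_Plus_frag_of:
  assumes "a \<in> basis K (Suc q)"
  shows "\<exists>b\<in>basis K q - thin K. bdry K Plus (frag_of a) = frag_of b"
proof -
  obtain b where b: "b \<in> all_basis K - thin K" "bdry K Plus (frag_of a) = frag_of b"
    using opetopic assms unfolding opetopic_directed_complex_def by (meson zero_less_Suc)
  then show ?thesis
    using keys_bdry[of "frag_of a" q Plus] assms by auto
qed

text \<open>Unitality for 0-dimensional basis elements, where no boundary is taken, says that the
  augmentation is 1 on each of them; linearity does the rest.\<close>

lemma aug_eq_total:
  assumes "keys c \<subseteq> basis K 0"
  shows "aug K c = total c"
proof -
  have hom: "aug K \<in> hom (free_Abelian_group (basis K 0)) integer_group"
    using complex(1) by (simp add: free_augmented_directed_complex_def chains_def)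
  interpret group_hom "free_Abelian_group (basis K 0)" integer_group "aug K"
    using hom by (simp add: group_hom_def group_hom_axioms_def group_integer_group)
  have add: "aug K (x + y) = aug K x + aug K y" if "keys x \<subseteq> basis K 0" "keys y \<subseteq> basis K 0" for x y
    using hom_mult[of x y] that by simp
  show ?thesis
    using assms
  proof (rule free_Abelian_group_induct)
    show "aug K 0 = total (0 :: 'a \<Rightarrow>\<^sub>0 int)"
      using hom_one by simp
    show "aug K (x - y) = total (x - y)"
      if "keys x \<subseteq> basis K 0" "keys y \<subseteq> basis K 0" "aug K x = total x" "aug K y = total y" for x y
    proof -
      have "keys (x - y) \<subseteq> basis K 0"
        using keys_diff[of x y] that by blast
      then have "aug K x = aug K (x - y) + aug K y"
        using add[of "x - y" y] that by simp
      then show ?thesis using that by simp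
    qed
    show "aug K (frag_of a) = total (frag_of a)" if "a \<in> basis K 0" for a
    proof -
      have "aug K ((bdry K Plus ^^ 0) (frag_of a)) = 1"
        using complex(4) that unfolding unital_def by blast
      then show ?thesis by simp
    qed
  qed
qed

section \<open>Fillings and the removal of a last cell\<close>

text \<open>Among the finitely many targets of terms of \<open>c\<close>, choose one that is maximal
  for the face order. If a term of \<open>c\<close> consumed it, the target of that term would be
  strictly later.\<close>

lemma exists_maximal_target:
  assumes "basis_sum c" "keys c \<subseteq> basis K (Suc q)" "c \<noteq> 0"
  shows "\<exists>a\<in>keys c. \<exists>b\<in>basis K q. bdry K Plus (frag_of a) = frag_of b \<and> b \<notin> keys (dminus K c)"
proof -
  have "keys (dplus K c) \<noteq> {}"
  proof -
    obtain a where "a \<in> keys c" using assms(3) by fastforce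
    then show ?thesis
      using bdry_Plus_frag_of[of a q] assms by (force simp: keys_dplus)
  qed
  moreover have "asymp_on (keys (dplus K c)) (\<lambda>d e. (d, e) \<in> (face_step K)\<^sup>+)"
    using acyclic_face_step[OF complex(3)]
    by (auto simp: asymp_on_def acyclic_def dest: trancl_trans)
  moreover have "transp_on (keys (dplus K c)) (\<lambda>d e. (d, e) \<in> (face_step K)\<^sup>+)"
    by (auto simp: transp_on_def)
  ultimately have "\<exists>b\<in>keys (dplus K c). \<forall>e\<in>keys (dplus K c). e \<noteq> b \<longrightarrow> (b, e) \<notin> (face_step K)\<^sup>+"
    by (intro Finite_Set.bex_max_element finite_keys)
  then obtain b where b: "b \<in> keys (dplus K c)"
      "\<And>e. \<lbrakk>e \<in> keys (dplus K c); e \<noteq> b\<rbrakk> \<Longrightarrow> (b, e) \<notin> (face_step K)\<^sup>+"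
    by blast
  obtain a where a: "a \<in> keys c" "b \<in> keys (bdry K Plus (frag_of a))"
    using b(1) assms(1) by (auto simp: keys_dplus)
  then obtain b' where b': "bdry K Plus (frag_of a) = frag_of b'" "b' \<in> basis K q"
    using bdry_Plus_frag_of[of a q] assms(2) by auto
  have "b \<notin> keys (dminus K c)"
  proof
    assume "b \<in> keys (dminus K c)"
    then obtain a' where a': "a' \<in> keys c" "b \<in> keys (bdry K Minus (frag_of a'))"
      using assms(1) by (auto simp: keys_dminus)
    obtain e where e: "bdry K Plus (frag_of a') = frag_of e"
      using bdry_Plus_frag_of[of a' q] a'(1) assms(2) by auto
    have step: "(b, e) \<in> face_step K"
      using a' e assms(2) by (auto simp: face_step_def intro!: bexI[of _ a'] all_basisI)
    then have "e \<noteq> b"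
      using acyclic_face_step[OF complex(3)] by (auto simp: acyclic_def)
    moreover have "e \<in> keys (dplus K c)"
      using a'(1) e assms(1) by (auto simp: keys_dplus intro!: bexI[of _ a'])
    ultimately show False
      using b(2) step by blast
  qed
  then show ?thesis
    using a b' by auto
qed

text \<open>A purely homological form of a pasting diagram \<open>c\<close> from \<open>x\<close> to
  \<open>y\<close>. Repetitions are allowed, as their absence is to be proved.\<close>

definition filling :: "nat \<Rightarrow> ('a \<Rightarrow>\<^sub>0 int) \<Rightarrow> ('a \<Rightarrow>\<^sub>0 int) \<Rightarrow> ('a \<Rightarrow>\<^sub>0 int) \<Rightarrow> bool"
  where "filling q x y c \<longleftrightarrow>
    keys x \<subseteq> basis K q \<and> keys y \<subseteq> basis K q \<and> keys c \<subseteq> basis K (Suc q) \<and>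
    basis_sum x \<and> basis_sum y \<and> basis_sum c \<and> bd K c = y - x"

text \<open>The same edges counted in two ways: inputs and edges produced on the left, outputs and
  edges consumed on the right.\<close>

lemma filling_eq: "filling q x y c \<Longrightarrow> x + dplus K c = y + dminus K c"
  using bd_eq[of c q] by (auto simp: filling_def algebra_simps)

text \<open>The removed cell \<open>a\<close> has a target \<open>b\<close> that no term of
  \<open>c\<close> consumes, so \<open>b\<close> survives into \<open>y\<close>. The equation of
  coefficients at \<open>b\<close> is recorded because it bounds the multiplicity of
  \<open>b\<close> later.\<close>

lemma filling_peel:
  assumes "filling q x y c" "c \<noteq> 0"
  obtains a b where "a \<in> keys c" "b \<in> keys y" "bdry K Plus (frag_of a) = frag_of b"
    "lookup (x + dplus K c) b = lookup y b"
    "filling q x (y - frag_of b + bdry K Minus (frag_of a)) (c - frag_of a)"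
proof -
  have f: "keys x \<subseteq> basis K q" "keys y \<subseteq> basis K q" "keys c \<subseteq> basis K (Suc q)"
    "basis_sum x" "basis_sum y" "basis_sum c" "bd K c = y - x"
    using assms by (auto simp: filling_def)
  obtain a b where ab: "a \<in> keys c" "bdry K Plus (frag_of a) = frag_of b"
      "b \<notin> keys (dminus K c)" "b \<in> basis K q"
    using exists_maximal_target[OF f(6,3) assms(2)] by blast
  have lb: "lookup (x + dplus K c) b = lookup y b"
    unfolding filling_eq[OF assms(1)] using ab(3) by (simp add: lookup_add in_keys_iff)
  have "b \<in> keys (x + dplus K c)"
    using ab f by (auto simp: keys_add_basis_sum basis_sum_dplus keys_dplus intro!: bexI[of _ a])
  then have bin: "b \<in> keys y"
    using lb by (simp add: in_keys_iff)
  have am: "keys (bdry K Minus (frag_of a)) \<subseteq> basis K q"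
    using keys_bdry[of "frag_of a" q] ab f by auto
  have "keys (y - frag_of b + bdry K Minus (frag_of a)) \<subseteq> basis K q"
    using keys_add[of "y - frag_of b" "bdry K Minus (frag_of a)"] keys_diff[of y "frag_of b"]
      am f(2) ab(4) by fastforce
  moreover have "keys (c - frag_of a) \<subseteq> basis K (Suc q)"
    using keys_diff[of c "frag_of a"] f ab by auto
  moreover have "bd K (c - frag_of a) = y - frag_of b + bdry K Minus (frag_of a) - x"
    using bd_diff[of c q "frag_of a"] f ab bdry_decomposition(4)[of K "frag_of a"] by auto
  ultimately have "filling q x (y - frag_of b + bdry K Minus (frag_of a)) (c - frag_of a)"
    using f ab bin by (simp add: filling_def basis_sum_remove basis_sum_add)
  then show thesis
    using that ab bin lb by blast
qed

section \<open>Multiplicity-freeness of fillings\<close>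

text \<open>All sums homologous to \<open>y\<close> are included because the induction below replaces the target of a
  filling by a homologous one.\<close>

definition stably_multiplicity_free :: "nat \<Rightarrow> ('a \<Rightarrow>\<^sub>0 int) \<Rightarrow> bool"
  where "stably_multiplicity_free q y \<longleftrightarrow>
    (\<forall>w. keys w \<subseteq> basis K (Suc q) \<longrightarrow> basis_sum (y + bd K w) \<longrightarrow> multiplicity_free (y + bd K w))"

text \<open>Induction on the number of terms of \<open>c\<close>: removing a last cell changes the
  target by a boundary, so the new target is again stably multiplicity-free.\<close>

lemma filling_multiplicity_free:
  assumes "filling q x y c" "stably_multiplicity_free q y"
  shows "multiplicity_free (x + dplus K c)"
  using assms
proof (induction "nat (total c)" arbitrary: y c rule: less_induct)
  case less
  have f: "basis_sum x" "basis_sum y" "basis_sum c" "keys c \<subseteq> basis K (Suc q)"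
    using less.prems by (auto simp: filling_def)
  have y: "multiplicity_free y"
    using less.prems(2) f unfolding stably_multiplicity_free_def by (metis add.right_neutral bd_0 empty_subsetI keys_zero)
  show ?case
  proof (cases "c = 0")
    case True
    then show ?thesis using y filling_eq[OF less.prems(1)] by simp
  next
    case False
    obtain a b where ab: "a \<in> keys c" "b \<in> keys y" "bdry K Plus (frag_of a) = frag_of b"
      "lookup (x + dplus K c) b = lookup y b"
      "filling q x (y - frag_of b + bdry K Minus (frag_of a)) (c - frag_of a)"
      using filling_peel[OF less.prems(1) False] by blast
    have ka: "keys (frag_of a) \<subseteq> basis K (Suc q)"
      using ab(1) f(4) by auto
    have "stably_multiplicity_free q (y - frag_of b + bdry K Minus (frag_of a))"
      unfolding stably_multiplicity_free_def
    proof (intro allI impI)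
      fix w assume w: "keys w \<subseteq> basis K (Suc q)"
        "basis_sum (y - frag_of b + bdry K Minus (frag_of a) + bd K w)"
      \<comment> \<open>The new target is \<open>y - bd K (frag_of a)\<close>, so the change is
        absorbed into \<open>w\<close>.\<close>
      have eq: "y - frag_of b + bdry K Minus (frag_of a) + bd K w = y + bd K (w - frag_of a)"
        using bdry_decomposition(4)[of K "frag_of a"] ab(3) bd_diff[OF w(1) ka] by simp
      have "keys (w - frag_of a) \<subseteq> basis K (Suc q)"
        using keys_diff[of w "frag_of a"] w(1) ka by blast
      then show "multiplicity_free (y - frag_of b + bdry K Minus (frag_of a) + bd K w)"
        using less.prems(2) w(2) unfolding stably_multiplicity_free_def eq by blast
    qed
    moreover have "nat (total (c - frag_of a)) < nat (total c)"
      using total_pos[OF f(3) ab(1)] by simp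
    ultimately have "multiplicity_free (x + dplus K (c - frag_of a))"
      using less.hyps ab(5) by blast
    then have IH: "multiplicity_free (x + dplus K c - frag_of b)"
      using ab(3) by (simp add: algebra_simps)
    show ?thesis
      unfolding multiplicity_free_def
    proof
      fix e
      \<comment> \<open>At \<open>b\<close> the induction hypothesis would only give the bound 2;
        there the coefficient is compared with that in \<open>y\<close> instead.\<close>
      show "lookup (x + dplus K c) e \<le> 1"
        using IH y ab(4) unfolding multiplicity_free_def
        by (cases "e = b") (auto simp: lookup_minus dest: spec[of _ e])
    qed
  qed
qed

text \<open>Adding a boundary to \<open>c\<close> does not change \<open>bd K c\<close>, so the
  result is another filling from \<open>x\<close> to \<open>y\<close>. Its positive faces are then
  free of repetitions, and being nonzero they pass this on to the filling.\<close>

lemma stably_multiplicity_free_Suc: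
  assumes "filling q x y c" "stably_multiplicity_free q y"
  shows "stably_multiplicity_free (Suc q) c"
  unfolding stably_multiplicity_free_def
proof (intro allI impI)
  fix w assume w: "keys w \<subseteq> basis K (Suc (Suc q))" "basis_sum (c + bd K w)"
  have k: "keys (bd K w) \<subseteq> basis K (Suc q)" "keys c \<subseteq> basis K (Suc q)"
    using keys_bd w assms(1) by (auto simp: filling_def)
  have kc: "keys (c + bd K w) \<subseteq> basis K (Suc q)"
    using k keys_add[of c "bd K w"] by blast
  then have "filling q x y (c + bd K w)"
    using w assms(1) k bd_bd[OF w(1)] bd_add[OF k(2,1)] by (auto simp: filling_def)
  then have "multiplicity_free (x + dplus K (c + bd K w))"
    using assms(2) filling_multiplicity_free by blast
  moreover have "basis_sum x"
    using assms(1) by (simp add: filling_def)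
  ultimately have "multiplicity_free (dplus K (c + bd K w))"
    using multiplicity_free_mono by fastforce
  moreover have "bdry K Plus (frag_of a) \<noteq> 0" if "a \<in> keys (c + bd K w)" for a
    using bdry_Plus_frag_of[of a q] that kc by auto
  ultimately show "multiplicity_free (c + bd K w)"
    unfolding dplus_def by (rule multiplicity_free_frag_extendD[OF w(2) basis_sum_bdry])
qed

text \<open>Boundaries have augmentation 0, so every sum of basis elements homologous to
  \<open>y\<close> has exactly one term.\<close>

lemma stably_multiplicity_free_0:
  assumes "keys y \<subseteq> basis K 0" "aug K y = 1"
  shows "stably_multiplicity_free 0 y"
  unfolding stably_multiplicity_free_def
proof (intro allI impI)
  fix w assume w: "keys w \<subseteq> basis K (Suc 0)" "basis_sum (y + bd K w)"
  have "\<forall>c\<in>carrier (chains K 1). aug K (bd K c) = 0"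
    using complex(1) unfolding free_augmented_directed_complex_def by blast
  then have "aug K (bd K w) = 0"
    using w(1) by (simp add: chains_def)
  then have "total (y + bd K w) = 1"
    using assms aug_eq_total keys_bd[OF w(1)] by simp
  then show "multiplicity_free (y + bd K w)"
    using w(2) multiplicity_free_total by blast
qed

section \<open>The canonical atom\<close>

abbreviation atom :: "sign \<Rightarrow> nat \<Rightarrow> 'a \<Rightarrow>\<^sub>0 int"
  where "atom \<equiv> canonical_atom n K"

lemma atom_Suc: "q < n \<Longrightarrow> atom \<alpha> q = bdry K \<alpha> (atom \<alpha> (Suc q))"
  unfolding canonical_atom_def by (simp flip: Suc_diff_Suc)

lemma top_basis: "basis K n = {the_elem (basis K n)}"
  using complex(2) by (auto simp: atomic_def)

lemma atom_top: "atom \<alpha> n = frag_of (the_elem (basis K n))" "q > n \<Longrightarrow> atom \<alpha> q = 0"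
  by (simp_all add: canonical_atom_def)

lemma keys_atom: "keys (atom \<alpha> q) \<subseteq> basis K q"
proof (cases "q \<le> n")
  case True
  then show ?thesis
  proof (induction rule: inc_induct)
    case base
    then show ?case using top_basis by (auto simp: atom_top)
  next
    case (step q)
    then show ?case by (simp add: atom_Suc keys_bdry)
  qed
qed (simp add: atom_top)

lemma basis_sum_atom: "basis_sum (atom \<alpha> q)"
  by (cases q n rule: linorder_cases) (simp_all add: atom_Suc atom_top)

lemma atom_Plus:
  assumes "q \<le> n"
  shows "\<exists>b\<in>basis K q. atom Plus q = frag_of b"
  using assms
proof (induction rule: inc_induct)
  case base
  then show ?case using top_basis by (simp add: atom_top) blast
next
  case (step q)
  then show ?case using bdry_Plus_frag_of by (fastforce simp: atom_Suc)
qed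

text \<open>The globular identities, by downward induction. They start at \<open>q = n\<close>,
  where both sides are 0 because the atom vanishes above dimension \<open>n\<close>.\<close>

lemma bd_atom:
  assumes "q \<le> n"
  shows "bd K (atom \<alpha> (Suc q)) = atom Plus q - atom Minus q"
  using assms
proof (induction arbitrary: \<alpha> rule: inc_induct)
  case base
  then show ?case by (simp add: atom_top)
next
  case (step q)
  \<comment> \<open>By the induction hypothesis the difference is itself a boundary, so both atoms
    in dimension \<open>Suc q\<close> have the same boundary and hence the same positive and
    negative parts.\<close>
  have "bd K (atom Plus (Suc q) - atom Minus (Suc q)) = 0"
    using step.IH[of Plus] bd_bd[OF keys_atom] by metis
  then have eq: "bd K (atom \<beta> (Suc q)) = bd K (atom \<alpha> (Suc q))" for \<alpha> \<beta>
    using bd_diff[OF keys_atom keys_atom, of Plus q Minus] by (cases \<alpha>; cases \<beta>) auto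
  have "atom Plus q - atom Minus q
      = bdry K Plus (atom \<alpha> (Suc q)) - bdry K Minus (atom \<alpha> (Suc q))"
    using step.hyps eq[of Plus \<alpha>] eq[of Minus \<alpha>] by (simp add: atom_Suc bdry.simps)
  then show ?case
    using bdry_decomposition(4)[of K "atom \<alpha> (Suc q)"] by simp
qed

lemma filling_atom: "q \<le> n \<Longrightarrow> filling q (atom Minus q) (atom Plus q) (atom \<alpha> (Suc q))"
  by (simp add: filling_def keys_atom basis_sum_atom bd_atom)

lemma aug_atom: "aug K (atom \<alpha> 0) = 1"
  using complex(4) top_basis by (auto simp: canonical_atom_def unital_def)

text \<open>The target \<open>atom Plus q\<close> carries the induction: the atoms of either sign
  one dimension up are fillings with this target.\<close>

lemma stably_multiplicity_free_atom: "q \<le> n \<Longrightarrow> stably_multiplicity_free q (atom \<alpha> q)"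
proof (induction q arbitrary: \<alpha>)
  case 0
  then show ?case by (simp add: stably_multiplicity_free_0 keys_atom aug_atom)
next
  case (Suc q)
  then show ?case using stably_multiplicity_free_Suc[OF filling_atom[of q \<alpha>]] by simp
qed

section \<open>Fillings in dimension 0 as paths\<close>

text \<open>By unitality both faces of a 1-dimensional basis element are single. Removing the last
  cell thus leaves a filling with a single target, whose path is extended by that cell and
  \<open>b\<close>.\<close>

lemma filling_0_path:
  assumes "filling 0 x (frag_of b) c"
  shows "\<exists>es vs. length es = Suc (length vs) \<and> set es = keys (x + dplus K c) \<and> set vs = keys c \<and>
    (\<forall>r<length vs. es ! r \<in> keys (bdry K Minus (frag_of (vs ! r))) \<and>
      es ! Suc r \<in> keys (bdry K Plus (frag_of (vs ! r)))) \<and> last es = b"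
  using assms
proof (induction "nat (total c)" arbitrary: b c rule: less_induct)
  case less
  have f: "basis_sum x" "basis_sum c" "keys c \<subseteq> basis K 1"
    using less.prems by (auto simp: filling_def)
  show ?case
  proof (cases "c = 0")
    case True
    then show ?thesis
      using filling_eq[OF less.prems] by (intro exI[of _ "[b]"] exI[of _ "[]"]) simp
  next
    case False
    \<comment> \<open>The removed cell has its target among the terms of \<open>frag_of b\<close>,
      so the target is \<open>b\<close> and the new target reduces to the negative face of
      \<open>a\<close>.\<close>
    obtain a where a: "a \<in> keys c" "bdry K Plus (frag_of a) = frag_of b"
        "filling 0 x (bdry K Minus (frag_of a)) (c - frag_of a)"
      using filling_peel[OF less.prems False] by (metis add_0 cancel_comm_monoid_add_class.diff_cancel
          insertE empty_iff keys_frag_of)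
    have "a \<in> basis K 1"
      using a(1) f(3) by blast
    then have "aug K ((bdry K Minus ^^ 1) (frag_of a)) = 1"
      using complex(4) unfolding unital_def by blast
    moreover have "keys (bdry K Minus (frag_of a)) \<subseteq> basis K 0"
      using a(3) by (simp add: filling_def)
    ultimately have "total (bdry K Minus (frag_of a)) = 1"
      using aug_eq_total by simp
    then obtain b' where b': "bdry K Minus (frag_of a) = frag_of b'"
      using total_eq_1D basis_sum_bdry by blast
    have c': "basis_sum (c - frag_of a)"
      using basis_sum_remove[OF f(2) a(1)] .
    have "nat (total (c - frag_of a)) < nat (total c)"
      using total_pos[OF f(2) a(1)] by simp
    then obtain es vs where IH: "length es = Suc (length vs)"
        "set es = keys (x + dplus K (c - frag_of a))" "set vs = keys (c - frag_of a)" "last es = b'"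
        "\<forall>r<length vs. es ! r \<in> keys (bdry K Minus (frag_of (vs ! r))) \<and>
          es ! Suc r \<in> keys (bdry K Plus (frag_of (vs ! r)))"
      using less.hyps a(3) unfolding b' by blast
    have "x + dplus K c = (x + dplus K (c - frag_of a)) + frag_of b"
      using a(2) by (simp add: algebra_simps)
    then have "keys (x + dplus K c) = keys (x + dplus K (c - frag_of a)) \<union> {b}"
      by (metis basis_sum_add basis_sum_dplus basis_sum_frag_of c' f(1) keys_add_basis_sum keys_frag_of)
    then have 1: "set (es @ [b]) = keys (x + dplus K c)"
      using IH(2) by simp
    have "keys c = keys (c - frag_of a) \<union> {a}"
      using keys_add_basis_sum[OF c' basis_sum_frag_of[of a]] by simp
    then have 2: "set (vs @ [a]) = keys c"
      using IH(3) by simp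
    have "es ! length vs = b'"
      using IH(1,4) last_conv_nth[of es] by (cases "es = []") auto
    then have 3: "\<forall>r<length (vs @ [a]). (es @ [b]) ! r \<in> keys (bdry K Minus (frag_of ((vs @ [a]) ! r))) \<and>
          (es @ [b]) ! Suc r \<in> keys (bdry K Plus (frag_of ((vs @ [a]) ! r)))"
      using IH(1,5) a(2) b' by (auto simp: nth_append less_Suc_eq)
    show ?thesis
      using IH(1) by (intro exI[of _ "es @ [b]"] exI[of _ "vs @ [a]"] conjI 1 2 3) simp_all
  qed
qed

end

section \<open>The network of a pasting diagram\<close>

text \<open>The choices by \<open>THE\<close> are unique once the edges are free of repetitions. The
  restricted domains then consist of the edges that are not inputs or not outputs, as the
  extensional form requires.\<close>

definition pasting_network ::
    "('a, 'm) odc_scheme \<Rightarrow> ('a \<Rightarrow>\<^sub>0 int) \<Rightarrow> ('a \<Rightarrow>\<^sub>0 int) \<Rightarrow> ('a \<Rightarrow>\<^sub>0 int) \<Rightarrow> ('a, 'a) thin_network"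
  where "pasting_network K x y c =
    \<lparr>edges = keys (x + dplus K c), verts = keys c, inputs = keys x, outputs = keys y,
     src = (\<lambda>e\<in>keys (dplus K c). THE a. a \<in> keys c \<and> e \<in> keys (bdry K Plus (frag_of a))),
     tgt = (\<lambda>e\<in>keys (dminus K c). THE a. a \<in> keys c \<and> e \<in> keys (bdry K Minus (frag_of a))),
     thin_edges = keys (x + dplus K c) \<inter> thin K, thin_verts = keys c \<inter> thin K\<rparr>"

locale pasting = opetopic_complex +
  fixes q :: nat and x y c :: "'a \<Rightarrow>\<^sub>0 int"
  assumes fill: "filling q x y c" and mf: "multiplicity_free (x + dplus K c)"
begin

abbreviation N where "N \<equiv> pasting_network K x y c"

lemma fill_simps:
  "keys x \<subseteq> basis K q" "keys y \<subseteq> basis K q" "keys c \<subseteq> basis K (Suc q)"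
  "basis_sum x" "basis_sum y" "basis_sum c" "bd K c = y - x"
  using fill by (simp_all add: filling_def)

lemma network_simps:
  "verts N = keys c" "inputs N = keys x" "outputs N = keys y"
  "thin_edges N = edges N \<inter> thin K" "thin_verts N = verts N \<inter> thin K"
  by (simp_all add: pasting_network_def)

lemma edges_eq: "edges N = keys x \<union> keys (dplus K c)" "edges N = keys y \<union> keys (dminus K c)"
proof -
  show "edges N = keys x \<union> keys (dplus K c)"
    using fill_simps by (simp add: pasting_network_def keys_add_basis_sum basis_sum_dplus)
  show "edges N = keys y \<union> keys (dminus K c)"
    using fill_simps by (simp add: pasting_network_def filling_eq[OF fill] keys_add_basis_sum basis_sum_dminus)
qed

text \<open>A common term would have a coefficient of at least 2. Hence the inputs are the edges no
  vertex produces, and the outputs those no vertex consumes.\<close>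

lemma disjoint: "keys x \<inter> keys (dplus K c) = {}" "keys y \<inter> keys (dminus K c) = {}"
proof -
  show "keys x \<inter> keys (dplus K c) = {}"
    using mf fill_simps by (intro disjoint_keys_multiplicity_free basis_sum_dplus)
  show "keys y \<inter> keys (dminus K c) = {}"
    using mf fill_simps unfolding filling_eq[OF fill] by (intro disjoint_keys_multiplicity_free basis_sum_dminus)
qed

lemma multiplicity_free_d:
  "multiplicity_free (dplus K c)" "multiplicity_free (dminus K c)"
proof -
  show "multiplicity_free (dplus K c)"
    by (rule multiplicity_free_mono[OF mf]) (simp add: fill_simps)
  show "multiplicity_free (dminus K c)"
    by (rule multiplicity_free_mono[OF mf[unfolded filling_eq[OF fill]]]) (simp add: fill_simps)
qed

lemma edges_minus: "edges N - inputs N = keys (dplus K c)" "edges N - outputs N = keys (dminus K c)"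
proof -
  show "edges N - inputs N = keys (dplus K c)"
    using disjoint(1) unfolding edges_eq(1) network_simps by blast
  show "edges N - outputs N = keys (dminus K c)"
    using disjoint(2) unfolding edges_eq(2) network_simps by blast
qed

lemma src_eq:
  assumes "a \<in> keys c" "e \<in> keys (bdry K Plus (frag_of a))"
  shows "e \<in> edges N - inputs N" "src N e = a"
proof -
  have e: "e \<in> keys (dplus K c)"
    using assms fill_simps by (auto simp: keys_dplus)
  then show "e \<in> edges N - inputs N"
    by (simp add: edges_minus)
  have "a' = a" if "a' \<in> keys c" "e \<in> keys (bdry K Plus (frag_of a'))" for a'
    using dplus_unique[OF fill_simps(6) multiplicity_free_d(1)] assms that by blast
  then have "(THE a. a \<in> keys c \<and> e \<in> keys (bdry K Plus (frag_of a))) = a"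
    using assms by (intro the_equality conjI) blast+
  then show "src N e = a"
    using e by (simp add: pasting_network_def)
qed

lemma tgt_eq:
  assumes "a \<in> keys c" "e \<in> keys (bdry K Minus (frag_of a))"
  shows "e \<in> edges N - outputs N" "tgt N e = a"
proof -
  have e: "e \<in> keys (dminus K c)"
    using assms fill_simps by (auto simp: keys_dminus)
  then show "e \<in> edges N - outputs N"
    by (simp add: edges_minus)
  have "a' = a" if "a' \<in> keys c" "e \<in> keys (bdry K Minus (frag_of a'))" for a'
    using dminus_unique[OF fill_simps(6) multiplicity_free_d(2)] assms that by blast
  then have "(THE a. a \<in> keys c \<and> e \<in> keys (bdry K Minus (frag_of a))) = a"
    using assms by (intro the_equality conjI) blast+
  then show "tgt N e = a"
    using e by (simp add: pasting_network_def)
qed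

lemma exists_src: "e \<in> edges N - inputs N \<Longrightarrow> \<exists>a\<in>keys c. e \<in> keys (bdry K Plus (frag_of a))"
  and exists_tgt: "e \<in> edges N - outputs N \<Longrightarrow> \<exists>a\<in>keys c. e \<in> keys (bdry K Minus (frag_of a))"
  using fill_simps by (simp_all add: edges_minus keys_dplus keys_dminus)

lemma src_fibre:
  assumes "a \<in> keys c"
  shows "{e \<in> edges N - inputs N. src N e = a} = keys (bdry K Plus (frag_of a))"
proof (intro equalityI subsetI)
  fix e assume e: "e \<in> {e \<in> edges N - inputs N. src N e = a}"
  then obtain a' where "a' \<in> keys c" "e \<in> keys (bdry K Plus (frag_of a'))"
    using exists_src[of e] by blast
  then show "e \<in> keys (bdry K Plus (frag_of a))"
    using src_eq(2)[of a' e] e by simp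
next
  fix e assume "e \<in> keys (bdry K Plus (frag_of a))"
  then show "e \<in> {e \<in> edges N - inputs N. src N e = a}"
    using src_eq[OF assms] by simp
qed

lemma tgt_fibre:
  assumes "a \<in> keys c"
  shows "{e \<in> edges N - outputs N. tgt N e = a} = keys (bdry K Minus (frag_of a))"
proof (intro equalityI subsetI)
  fix e assume e: "e \<in> {e \<in> edges N - outputs N. tgt N e = a}"
  then obtain a' where "a' \<in> keys c" "e \<in> keys (bdry K Minus (frag_of a'))"
    using exists_tgt[of e] by blast
  then show "e \<in> keys (bdry K Minus (frag_of a))"
    using tgt_eq(2)[of a' e] e by simp
next
  fix e assume "e \<in> keys (bdry K Minus (frag_of a))"
  then show "e \<in> {e \<in> edges N - outputs N. tgt N e = a}"
    using tgt_eq[OF assms] by simp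
qed

lemma src_iff:
  assumes "a \<in> keys c"
  shows "e \<in> keys (bdry K Plus (frag_of a)) \<longleftrightarrow> e \<in> edges N \<and> e \<notin> inputs N \<and> src N e = a"
  by (subst src_fibre[OF assms, symmetric]) simp

lemma tgt_iff:
  assumes "a \<in> keys c"
  shows "e \<in> keys (bdry K Minus (frag_of a)) \<longleftrightarrow> e \<in> edges N \<and> e \<notin> outputs N \<and> tgt N e = a"
  by (subst tgt_fibre[OF assms, symmetric]) simp

lemma network_pasting_network: "network N"
  unfolding network_def
proof (intro conjI)
  show "src N \<in> (edges N - inputs N) \<rightarrow>\<^sub>E verts N"
  proof (intro PiE_I)
    show "src N e \<in> verts N" if "e \<in> edges N - inputs N" for e
      using exists_src[OF that] src_eq by (auto simp: network_simps)
  qed (simp add: edges_minus, simp add: pasting_network_def)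
  show "tgt N \<in> (edges N - outputs N) \<rightarrow>\<^sub>E verts N"
  proof (intro PiE_I)
    show "tgt N e \<in> verts N" if "e \<in> edges N - outputs N" for e
      using exists_tgt[OF that] tgt_eq by (auto simp: network_simps)
  qed (simp add: edges_minus, simp add: pasting_network_def)
qed (use edges_eq in \<open>auto simp: network_simps\<close>)

section \<open>Acyclicity and thinness in the network\<close>

lemma edge_step_eq:
  "edge_step N = {(d, e). \<exists>a\<in>keys c. d \<in> keys (bdry K Minus (frag_of a)) \<and> e \<in> keys (bdry K Plus (frag_of a))}"
  (is "_ = ?R")
proof (rule equalityI; rule subrelI)
  fix d e assume *: "(d, e) \<in> edge_step N"
  then have "d \<in> edges N - outputs N" "e \<in> edges N - inputs N" and eq: "tgt N d = src N e"
    by (simp_all add: edge_step_def)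
  then obtain a b where ab: "a \<in> keys c" "d \<in> keys (bdry K Minus (frag_of a))"
      "b \<in> keys c" "e \<in> keys (bdry K Plus (frag_of b))"
    using exists_src exists_tgt by meson
  then have "a = b"
    using eq tgt_eq(2)[OF ab(1,2)] src_eq(2)[OF ab(3,4)] by simp
  then show "(d, e) \<in> ?R"
    using ab by blast
next
  fix d e assume "(d, e) \<in> ?R"
  then obtain a where a: "a \<in> keys c" "d \<in> keys (bdry K Minus (frag_of a))"
      "e \<in> keys (bdry K Plus (frag_of a))"
    by blast
  then show "(d, e) \<in> edge_step N"
    using tgt_eq[OF a(1,2)] src_eq[OF a(1,3)] by (simp add: edge_step_def network_simps)
qed

lemma acyclic_edge_step: "acyclic (edge_step N)"
proof (rule acyclic_subset[OF acyclic_face_step[OF complex(3)]])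
  have "keys c \<subseteq> all_basis K"
    using fill_simps(3) all_basisI by blast
  then show "edge_step N \<subseteq> face_step K"
    unfolding edge_step_eq face_step_def by blast
qed

lemma bdry_Plus_vertex:
  "a \<in> keys c \<Longrightarrow> \<exists>b\<in>basis K q - thin K. bdry K Plus (frag_of a) = frag_of b"
  using bdry_Plus_frag_of fill_simps(3) by blast

lemma edges_subset_basis: "edges N \<subseteq> basis K q"
proof -
  have "keys (bdry K Plus (frag_of a)) \<subseteq> basis K q" if "a \<in> keys c" for a
    using bdry_Plus_vertex[OF that] by auto
  then show ?thesis
    using fill_simps unfolding edges_eq(1) by (auto simp: keys_dplus)
qed

text \<open>An edge that is not an input is the positive face of some vertex, and positive faces are
  non-thin.\<close>

lemma thin_edges_subset_inputs: "thin_edges N \<subseteq> inputs N"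
proof (rule ccontr)
  assume "\<not> thin_edges N \<subseteq> inputs N"
  then obtain e where e: "e \<in> edges N - inputs N" "e \<in> thin K"
    by (auto simp: network_simps(4))
  then obtain a where "a \<in> keys c" "e \<in> keys (bdry K Plus (frag_of a))"
    using exists_src by blast
  then show False
    using bdry_Plus_vertex[of a] e by auto
qed

lemma opetopic_pasting_network:
  assumes "keys y = {b}"
  shows "opetopic_network N"
  unfolding opetopic_network_def
proof (intro conjI ballI)
  show "\<exists>!e. e \<in> outputs N"
    by (simp add: network_simps assms)
  show "thin_edges N \<subseteq> inputs N"
    by (rule thin_edges_subset_inputs)
  fix v assume v: "v \<in> thin_verts N"
  then have "v \<in> thin K" "v \<in> keys c"
    by (simp_all add: network_simps)
  \<comment> \<open>The edges with target \<open>v\<close> are the terms of its negative face, which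
    for a thin \<open>v\<close> is one non-thin basis element.\<close>
  then obtain b where b: "b \<notin> thin K" "bdry K Minus (frag_of v) = frag_of b"
    using opetopic unfolding opetopic_directed_complex_def by blast
  show "\<exists>e. {e' \<in> edges N - outputs N. tgt N e' = v} = {e} \<and> e \<notin> thin_edges N"
  proof (intro exI conjI)
    show "{e' \<in> edges N - outputs N. tgt N e' = v} = {b}"
      unfolding tgt_fibre[OF \<open>v \<in> keys c\<close>] b(2) by simp
    show "b \<notin> thin_edges N"
      using b(1) by (simp add: network_simps(4))
  qed
qed (simp_all add: network_pasting_network acyclic_network_edge_step acyclic_edge_step network_simps(5))

section \<open>The boundary of the inputs below an edge\<close>

text \<open>The vertices on paths leading to \<open>e\<close> form a filling from the inputs below
  \<open>e\<close> to \<open>e\<close> itself, and \<open>\<partial>\<partial> = 0\<close>. Since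
  \<open>q\<close> is positive, the boundary can be applied to each of the two separately.\<close>

lemma bd_inputs_below:
  assumes e: "e \<in> edges N" and q: "q = Suc p"
  shows "bd K (chain_of (inputs_below N e)) = bd K (frag_of e)"
proof -
  \<comment> \<open>\<open>D\<close> consists of the edges from which \<open>e\<close> can be
    reached, and \<open>W\<close> of the vertices producing an edge of \<open>D\<close>.\<close>
  define D where "D = {d. (d, e) \<in> (edge_step N)\<^sup>*}"
  define W where "W = {v \<in> keys c. \<exists>d\<in>D. d \<in> keys (bdry K Plus (frag_of v))}"
  have W: "W \<subseteq> keys c" and fin: "finite W"
    by (auto simp: W_def)
  have below: "inputs_below N e = keys x \<inter> D"
    unfolding inputs_below_def D_def network_simps
    using path_from_to_edge_step edge_step_path_from_to[OF _ e] by fast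
  have D: "d \<in> edges N" if "d \<in> D" for d
    using that e unfolding D_def by (auto elim: converse_rtranclE simp: edge_step_def)
  have plus: "(\<exists>v\<in>W. d \<in> keys (bdry K Plus (frag_of v))) \<longleftrightarrow> d \<in> D \<and> d \<notin> keys x" for d
  proof
    assume "\<exists>v\<in>W. d \<in> keys (bdry K Plus (frag_of v))"
    then obtain v d' where v: "v \<in> keys c" "d \<in> keys (bdry K Plus (frag_of v))"
        "d' \<in> D" "d' \<in> keys (bdry K Plus (frag_of v))"
      by (auto simp: W_def)
    \<comment> \<open>A vertex produces only one edge, so everything produced by \<open>W\<close>
      stays in \<open>D\<close>.\<close>
    then have "d' = d"
      using bdry_Plus_vertex[of v] by auto
    then show "d \<in> D \<and> d \<notin> keys x"
      using v src_eq(1)[of v d] by (simp add: network_simps)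
  next
    assume d: "d \<in> D \<and> d \<notin> keys x"
    then have "d \<in> edges N - inputs N"
      using D by (simp add: network_simps)
    then show "\<exists>v\<in>W. d \<in> keys (bdry K Plus (frag_of v))"
      using exists_src d unfolding W_def by blast
  qed
  have minus: "(\<exists>v\<in>W. d \<in> keys (bdry K Minus (frag_of v))) \<longleftrightarrow> d \<in> D \<and> d \<noteq> e" for d
  proof
    assume "\<exists>v\<in>W. d \<in> keys (bdry K Minus (frag_of v))"
    then obtain d' where "d' \<in> D" "(d, d') \<in> edge_step N"
      unfolding W_def edge_step_eq by blast
    \<comment> \<open>An edge consumed by \<open>W\<close> reaches \<open>e\<close> in at least one
      step; acyclicity then excludes \<open>e\<close> itself.\<close>
    then have "(d, e) \<in> (edge_step N)\<^sup>+"
      unfolding D_def by auto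
    then show "d \<in> D \<and> d \<noteq> e"
      using acyclic_edge_step by (auto simp: D_def acyclic_def)
  next
    assume "d \<in> D \<and> d \<noteq> e"
    then obtain d' where "d' \<in> D" "(d, d') \<in> edge_step N"
      unfolding D_def by (auto elim: converse_rtranclE)
    then show "\<exists>v\<in>W. d \<in> keys (bdry K Minus (frag_of v))"
      unfolding W_def edge_step_eq by blast
  qed
  have lp: "lookup (dplus K (chain_of W)) d = of_bool (d \<in> D \<and> d \<notin> keys x)" for d
    unfolding lookup_dplus_chain_of[OF fill_simps(6) multiplicity_free_d(1) W] plus ..
  have lm: "lookup (dminus K (chain_of W)) d = of_bool (d \<in> D \<and> d \<noteq> e)" for d
    unfolding lookup_dminus_chain_of[OF fill_simps(6) multiplicity_free_d(2) W] minus ..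
  have kW: "keys (chain_of W) \<subseteq> basis K (Suc q)"
    using W fill_simps(3) fin by simp
  have "e \<in> D"
    by (simp add: D_def)
  \<comment> \<open>Edges of \<open>D\<close> other than \<open>e\<close> and the inputs are both
    produced and consumed by \<open>W\<close>, so they cancel. If \<open>e\<close> is itself an
    input, both sides are 0.\<close>
  then have "bd K (chain_of W) = frag_of e - chain_of (inputs_below N e)"
    unfolding bd_eq[OF kW]
    by (intro poly_mapping_eqI) (auto simp: lookup_minus lp lm below lookup_chain_of)
  then have "bd K (frag_of e - chain_of (inputs_below N e)) = 0"
    using bd_bd[OF kW] by simp
  moreover have "keys (frag_of e) \<subseteq> basis K (Suc p)"
    using e edges_subset_basis q by auto
  moreover have "keys (chain_of (inputs_below N e)) \<subseteq> basis K (Suc p)"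
    using fill_simps(1) q by (auto simp: below)
  ultimately show ?thesis
    using bd_diff by fastforce
qed

lemma linear_pasting_network:
  assumes "q = 0" "y = frag_of b"
  shows "linear_network N"
proof -
  obtain es vs where *: "length es = Suc (length vs)" "set es = keys (x + dplus K c)" "set vs = keys c"
    "\<forall>r<length vs. es ! r \<in> keys (bdry K Minus (frag_of (vs ! r))) \<and>
      es ! Suc r \<in> keys (bdry K Plus (frag_of (vs ! r)))"
    using filling_0_path[OF fill[unfolded assms]] by (elim exE conjE) (rule that)
  have "is_path N es vs"
    unfolding is_path_def
  proof (intro conjI allI impI)
    show "set es \<subseteq> edges N" "set vs \<subseteq> verts N"
      using * by (simp_all add: pasting_network_def)
    fix r assume "r < length vs"
    then have r: "vs ! r \<in> keys c" "es ! r \<in> keys (bdry K Minus (frag_of (vs ! r)))"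
      "es ! Suc r \<in> keys (bdry K Plus (frag_of (vs ! r)))"
      using *(4) nth_mem[of r vs] unfolding *(3) by simp_all
    show "es ! r \<notin> outputs N" "tgt N (es ! r) = vs ! r"
      "es ! Suc r \<notin> inputs N" "src N (es ! Suc r) = vs ! r"
      using tgt_eq[OF r(1,2)] src_eq[OF r(1,3)] by simp_all
  qed (rule *)
  moreover have "edges N = set es" "verts N = set vs"
    using * by (simp_all add: pasting_network_def)
  ultimately show ?thesis
    using acyclic_network_edge_step[OF acyclic_edge_step] unfolding linear_network_def by blast
qed

end

section \<open>Constellations between consecutive networks\<close>

context opetopic_complex
begin

text \<open>The chain \<open>c\<close> supplies both the vertices of the first network and the
  inputs of the second, so the bijection is the identity. The edges with a source but no target in
  the inputs below \<open>e\<close> are the terms of the positive boundary of the sum of these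
  inputs, which equals \<open>\<partial>\<^sup>+e\<close>.\<close>

lemma constellation_pasting_network:
  assumes "pasting K n q x y c" and "pasting K n (Suc q) c z w"
  shows "constellation (pasting_network K x y c) (pasting_network K c z w) (\<lambda>a. a)"
proof -
  interpret N: pasting K n q x y c by fact
  interpret P: pasting K n "Suc q" c z w by fact
  have "\<exists>!d. d \<in> edges N.N \<and> (d \<notin> inputs N.N \<and> src N.N d \<in> S) \<and> \<not> (d \<notin> outputs N.N \<and> tgt N.N d \<in> S)"
    if e: "e \<in> edges P.N" and S: "S = inputs_below P.N e" for e S
  proof -
    have Sc: "S \<subseteq> keys c"
      by (auto simp: S inputs_below_def P.network_simps)
    then have fin: "finite S"
      by (rule finite_subset) simp
    have "e \<in> basis K (Suc q)"
      using e P.edges_subset_basis by blast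
    then obtain b where b: "bdry K Plus (frag_of e) = frag_of b"
      using bdry_Plus_frag_of by blast
    have kS: "keys (chain_of S) \<subseteq> basis K (Suc q)"
      using Sc fin N.fill_simps(3) by simp
    \<comment> \<open>\<open>bdry\<close> depends on a chain only through its boundary, which is
      that of \<open>e\<close>.\<close>
    have "bdry K Plus (chain_of S) = frag_of b"
      using P.bd_inputs_below[OF e refl] b by (simp add: S bdry.simps)
    then have lookup_b: "lookup (frag_of b) d
        = max (lookup (dplus K (chain_of S)) d - lookup (dminus K (chain_of S)) d) 0" for d
      using bd_eq[OF kS] lookup_bdry(1)[of K "chain_of S" d] by (simp add: lookup_minus)
    let ?A = "\<lambda>d. d \<in> edges N.N \<and> d \<notin> inputs N.N \<and> src N.N d \<in> S"
    let ?B = "\<lambda>d. d \<in> edges N.N \<and> d \<notin> outputs N.N \<and> tgt N.N d \<in> S"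
    have A: "lookup (dplus K (chain_of S)) d = of_bool (?A d)" for d
    proof -
      have "(\<exists>a\<in>S. d \<in> keys (bdry K Plus (frag_of a))) \<longleftrightarrow> ?A d"
        using Sc by (simp add: N.src_iff subset_iff cong: bex_cong)
      then show ?thesis
        by (simp only: lookup_dplus_chain_of[OF N.fill_simps(6) N.multiplicity_free_d(1) Sc])
    qed
    have B: "lookup (dminus K (chain_of S)) d = of_bool (?B d)" for d
    proof -
      have "(\<exists>a\<in>S. d \<in> keys (bdry K Minus (frag_of a))) \<longleftrightarrow> ?B d"
        using Sc by (simp add: N.tgt_iff subset_iff cong: bex_cong)
      then show ?thesis
        by (simp only: lookup_dminus_chain_of[OF N.fill_simps(6) N.multiplicity_free_d(2) Sc])
    qed
    \<comment> \<open>The positive part of a difference of two truth values is 1 exactly when the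
      first holds and the second fails.\<close>
    have positive_part: "P \<and> \<not> Q \<longleftrightarrow> d = b"
      if "lookup (frag_of b) d = max (of_bool P - of_bool Q) 0" for P Q d
      using that by (cases P; cases Q) (simp_all split: if_splits)
    have "?A d \<and> \<not> ?B d \<longleftrightarrow> d = b" for d
      by (rule positive_part) (use lookup_b[of d] in \<open>simp only: A B\<close>)
    then have iff: "d \<in> edges N.N \<and> (d \<notin> inputs N.N \<and> src N.N d \<in> S) \<and> \<not> (d \<notin> outputs N.N \<and> tgt N.N d \<in> S)
        \<longleftrightarrow> d = b" for d
      by blast
    show ?thesis
      unfolding iff by blast
  qed
  moreover have "{v \<in> verts N.N. v \<in> inputs_below P.N e} = inputs_below P.N e" for e
    by (auto simp: inputs_below_def N.network_simps P.network_simps)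
  \<comment> \<open>Thin edges are inputs, so the thin edges of the second network are the thin
    terms of \<open>c\<close>, that is, the thin vertices of the first.\<close>
  moreover have "thin_edges P.N = keys c \<inter> thin K"
    using P.thin_edges_subset_inputs P.edges_eq(1) by (auto simp: P.network_simps)
  ultimately show ?thesis
    by (simp add: constellation_def Let_def N.network_simps P.network_simps bij_betw_def)
qed

text \<open>The case \<open>q = n\<close> is included: the filling is then 0, giving one edge and no
  vertices.\<close>

lemma pasting_atom:
  assumes "q \<le> n"
  shows "pasting K n q (atom Minus q) (atom Plus q) (atom Minus (Suc q))"
proof unfold_locales
  show "filling q (atom Minus q) (atom Plus q) (atom Minus (Suc q))"
    using assms by (rule filling_atom)
  then show "multiplicity_free (atom Minus q + dplus K (atom Minus (Suc q)))"
    by (rule filling_multiplicity_free[OF _ stably_multiplicity_free_atom[OF assms]])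
qed

end

section \<open>The opetopic sequence of an opetopic directed complex\<close>

theorem theorem5p2:
  fixes K :: "('a, 'm) odc_scheme" and n :: nat
  assumes "opetopic_directed_complex n K"
  shows "\<exists>N :: nat \<Rightarrow> ('a, 'a) thin_network.
    (\<forall>q \<le> n. is_G_minus K (canonical_atom n K) q (N q)) \<and>
    (\<forall>q \<le> n. thin_edges (N q) = edges (N q) \<inter> thin K \<and>
              thin_verts (N q) = verts (N q) \<inter> thin K) \<and>
    opetopic_sequence n N (\<lambda>q a. a)"
proof -
  interpret opetopic_complex K n
    by unfold_locales (fact assms)
  define N where "N q = pasting_network K (atom Minus q) (atom Plus q) (atom Minus (Suc q))" for q
  have G: "is_G_minus K atom q (N q)" if "q \<le> n" for q
  proof -
    interpret pasting K n q "atom Minus q" "atom Plus q" "atom Minus (Suc q)"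
      using that by (rule pasting_atom)
    have "edges (N q) = keys (g_minus K atom q)"
      by (simp add: N_def pasting_network_def g_minus_def dplus_def)
    then show ?thesis
      using network_pasting_network src_fibre tgt_fibre
      by (simp add: is_G_minus_def network_simps N_def)
  qed
  have thin: "thin_edges (N q) = edges (N q) \<inter> thin K \<and> thin_verts (N q) = verts (N q) \<inter> thin K" for q
    by (simp add: N_def pasting_network_def)
  have ope: "opetopic_network (N q)" if q: "q \<le> n" for q
    using pasting.opetopic_pasting_network[OF pasting_atom[OF q]] atom_Plus[OF q] by (force simp: N_def)
  have con: "constellation (N q) (N (Suc q)) (\<lambda>a. a)" if "q < n" for q
    unfolding N_def
    using that by (intro constellation_pasting_network[where q = q] pasting_atom) simp_all
  have lin: "linear_network (N 0)"
    using pasting.linear_pasting_network[OF pasting_atom[of 0]] atom_Plus[of 0] by (auto simp: N_def)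
  \<comment> \<open>Thin basis elements have positive dimension and the bases are disjoint, so no
    edge of the first network is thin.\<close>
  have "\<forall>q>0. basis K 0 \<inter> basis K q = {}"
    using complex(1) unfolding free_augmented_directed_complex_def by simp
  moreover have "thin K \<subseteq> (\<Union>q\<in>{0<..}. basis K q)"
    using assms unfolding opetopic_directed_complex_def by blast
  ultimately have "basis K 0 \<inter> thin K = {}"
    by blast
  moreover have "edges (N 0) \<subseteq> basis K 0"
    using pasting.edges_subset_basis[OF pasting_atom[of 0]] by (simp add: N_def)
  ultimately have thin0: "thin_edges (N 0) = {}"
    by (auto simp: N_def pasting_network_def)
  \<comment> \<open>Here \<open>atom Minus (Suc n)\<close> is 0, so only the top basis element
    remains, as an edge.\<close>
  have "edges (N n) = {the_elem (basis K n)}" "verts (N n) = {}"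
    by (simp_all add: N_def pasting_network_def atom_top)
  then have "opetopic_sequence n N (\<lambda>q a. a)"
    using ope con lin thin0 by (simp add: opetopic_sequence_def)
  then show ?thesis
    using G thin by blast
qed

end
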